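(* Suppose the induced MDP is semicontinuous and the Slater condition holds: there exists $\mu\in\mathcal D$ such that $\int_{\mathbf V\times\mathbf B}\bar C_j(x,b)\mu(dx\times db)<d_j$ for all $j=1,\dots,J$. Then the following assertions hold. (a) The value of the primal convex program satisfies $\inf_{\mu\in\mathcal D}\sup_{\bar g\in\mathbb R_+^J}L_1(\mu,\bar g)=\sup_{\bar g\in\mathbb R_+^J}\inf_{\mu\in\mathcal D}L_1(\mu,\bar g)$; there exists at least one $\bar g^*\in\mathbb R_+^J$ solving the dual problem; and the dual functional $h(\bar g):=\inf_{\mu\in\mathcal D}L_1(\mu,\bar g)$, $\bar g\in\mathbb R_+^J$, is concave. (b) Consider a pair $(\mu^*,\bar g^* )\in\mathcal D\times\mathbb R_+^J$. Then $\mu^*$ is an optimal solution to the primal convex program and $\bar g^*$ is an optimal solution to the dual problem if and only if one of the following two equivalent statements holds. (i) The pair $(\mu^*,\bar g^* )$ is a saddle point of the Lagrangian: $L_1(\mu^*,\bar g)\le L_1(\mu^*,\bar g^* )\le L_1(\mu,\bar g^* )$ for all $\mu\in\mathcal D$, $\bar g\in\mathbb R_+^J$. (ii) The following relations hold: $\int_{\mathbf V\times\mathbf B}\bar C_j(x,b)\mu^*(dx\times db)\le d_j$ for $j=1,\dots,J$; $L_1(\mu^*,\bar g^* )=\inf_{\mu\in\mathcal D}L_1(\mu,\bar g^* )$; and $\sum_{j=1}^Jg_j^*\left(\int_{\mathbf V\times\mathbf B}\bar C_j(x,b)\mu^*(dx\times db)-d_j\right)=0$.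
   Context: Impulse control model. $\mathbf X$ and $\mathbf A$ are nonempty Borel subsets of complete separable metric spaces; measurability means Borel measurability. $\phi:\mathbf X\times[0,\infty)\to\mathbf X$ is measurable with $\phi(x,0)=x$, $\lim_{t\downarrow0}\phi(\phi(x,s),t)=\phi(x,s)$ and $\phi(x,s+t)=\phi(\phi(x,s),t)$ for all $x\in\mathbf X$, $s,t\ge0$. $l:\mathbf X\times\mathbf A\to\mathbf X$ is measurable; $\alpha\in(0,\infty)$; $J\ge0$ is an integer; for $j=0,\dots,J$, $C^g_j:\mathbf X\to[0,\infty]$ and $C^I_j:\mathbf X\times\mathbf A\to[0,\infty]$ are measurable; $d_1,\dots,d_J\in[0,\infty)$ are constants. Measures are $[0,\infty]$-valued; $\mathbb R_+^J=[0,\infty)^J$. Induced MDP. State space $\mathbf X_\Delta=\mathbf X\cup\{\Delta\}$ with $\Delta\notin\mathbf X$ an isolated point; action space $\mathbf B=[0,\infty]\times\mathbf A$, where $[0,\infty]$ is the one-point compactification of $[0,\infty)$; transition kernel $Q(dy|x,(\theta,a))=e^{-\alpha\theta}\delta_{l(\phi(x,\theta),a)}(dy)+(1-e^{-\alpha\theta})\delta_\Delta(dy)$ if $x\ne\Delta$, $\theta\neq\infty$, and $\delta_\Delta(dy)$ otherwise; costs $\bar C_j(x,(\theta,a))=\int_0^\theta e^{-\alpha t}C^g_j(\phi(x,t))\,dt+e^{-\alpha\theta}C^I_j(\phi(x,\theta),a)$ for $x\in\mathbf X$ (the last term being $0$ if $\theta=\infty$), and $\bar C_j(\Delta,\cdot)=0$.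 Strategies. A strategy $\pi=\{\pi_i\}_{i\ge1}$ is a sequence of stochastic kernels $\pi_i(db|h_{i-1})$ on $\mathbf B$ given histories $h_{i-1}=(x_0,b_1,x_1,\dots,b_{i-1},x_{i-1})$. $\mathsf P^\pi_x$, $\mathsf E^\pi_x$ denote the probability and expectation on $(\mathbf X_\Delta\times\mathbf B)^\infty$, with coordinates $X_0,B_1,X_1,B_2,\dots$, under which $X_0=x$, $B_i$ has conditional law $\pi_i(\cdot|H_{i-1})$ given the history $H_{i-1}=(X_0,B_1,\dots,X_{i-1})$, and $X_i$ has conditional law $Q(\cdot|X_{i-1},B_i)$ given $(H_{i-1},B_i)$. For a cost $\bar C$, $\mathcal V(x,\pi,\bar C)=\mathsf E^\pi_x[\sum_{i=1}^\infty\bar C(X_{i-1},B_i)]$. The induced MDP is semicontinuous if $\mathbf B$ is compact, $(x,b)\mapsto\int_{\mathbf X_\Delta}u(y)Q(dy|x,b)$ is continuous for every bounded continuous $u$ on $\mathbf X_\Delta$, and each $\bar C_j$ is lower semicontinuous on $\mathbf X_\Delta\times\mathbf B$. Let $\mathbf V=\{x\in\mathbf X_\Delta:\inf_\pi\mathcal V(x,\pi,\sum_{j=0}^J\bar C_j)>0\}$. Standing assumption: the fixed initial state $x_0$ lies in $\mathbf V$. $\mathcal D$ is the set of measures $\mu$ on $\mathbf V\times\mathbf B$ such that the marginal $\mu(dx\times\mathbf B)$ is $\sigma$-finite on $\mathbf V$; $\mu(\Gamma\times\mathbf B)=\delta_{x_0}(\Gamma)+\int_{\mathbf V\times\mathbf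 B}Q(\Gamma|y,b)\mu(dy\times db)$ for all $\Gamma\in\mathcal B(\mathbf V)$; and $\int_{\mathbf V\times\mathbf B}\sum_{j=0}^J\bar C_j\,d\mu<\infty$. Lagrangian: $L_1(\mu,\bar g)=\int_{\mathbf V\times\mathbf B}\bar C_0\,d\mu+\sum_{j=1}^Jg_j\left(\int_{\mathbf V\times\mathbf B}\bar C_j\,d\mu-d_j\right)$ for $\mu\in\mathcal D$, $\bar g=(g_1,\dots,g_J)\in\mathbb R_+^J$ (real-valued). Primal convex program: minimize $\sup_{\bar g\in\mathbb R_+^J}L_1(\mu,\bar g)$ over $\mu\in\mathcal D$. Dual problem: maximize $\inf_{\mu\in\mathcal D}L_1(\mu,\bar g)$ over $\bar g\in\mathbb R_+^J$. *)

theory Defs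
  imports "HOL-Probability.Probability"
begin

text \<open>
  The space $X \cup \{\Delta\}$ is rendered by the option type, with \<^term>\<open>None\<close> as the
  isolated cemetery $\Delta$.
\<close>

instantiation option :: (topological_space) topological_space
begin

definition open_option_def: "open (U :: 'a option set) \<longleftrightarrow> open (Some -` U)"

instance
proof
  fix K :: "'a option set set"
  assume "\<forall>S\<in>K. open S"
  then show "open (\<Union>K)"
    unfolding open_option_def vimage_Union by blast
qed (auto simp: open_option_def)

end

text \<open>
  Lower semicontinuity of \<^term>\<open>f\<close> on a subset \<^term>\<open>S\<close>, in the subspace topology.
  \<^term>\<open>at z within S\<close> excludes \<^term>\<open>z\<close> itself, and \<^const>\<open>Liminf\<close> is \<^term>\<open>top\<close> at isolated points.
\<close>

definition lsc_on :: "'z::topological_space set \<Rightarrow> ('z \<Rightarrow> ennreal) \<Rightarrow> bool" where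
  "lsc_on S f \<longleftrightarrow> (\<forall>z\<in>S. f z \<le> Liminf (at z within S) f)"

text \<open>
  The fields \<^term>\<open>run_cost\<close> and \<^term>\<open>imp_cost\<close> are the families $C^g_j$ and $C^I_j$ with
  $0 \le j \le J$, and \<^term>\<open>bound\<close> is $d_j$ with $1 \le j \le J$; values at other indices, and
  values of functions off the carriers, play no role.
\<close>

record ('x, 'a) impulse_model =
  state_set :: "'x set"
  impulse_set :: "'a set"
  flow :: "'x \<Rightarrow> real \<Rightarrow> 'x"
  jump :: "'x \<Rightarrow> 'a \<Rightarrow> 'x"
  discount :: real
  ncons :: nat
  run_cost :: "nat \<Rightarrow> 'x \<Rightarrow> ennreal"
  imp_cost :: "nat \<Rightarrow> 'x \<Rightarrow> 'a \<Rightarrow> ennreal"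
  bound :: "nat \<Rightarrow> real"

definition valid_model :: "('x::polish_space, 'a::polish_space) impulse_model \<Rightarrow> bool" where
  "valid_model M \<longleftrightarrow>
     state_set M \<in> sets borel \<and> state_set M \<noteq> {} \<and>
     impulse_set M \<in> sets borel \<and> impulse_set M \<noteq> {} \<and>
     (\<lambda>(x, t). flow M x t) \<in>
       restrict_space borel (state_set M \<times> {0..}) \<rightarrow>\<^sub>M restrict_space borel (state_set M) \<and>
     (\<forall>x\<in>state_set M. flow M x 0 = x) \<and>
     (\<forall>x\<in>state_set M. \<forall>s\<ge>0. ((\<lambda>t. flow M (flow M x s) t) \<longlongrightarrow> flow M x s) (at_right 0)) \<and>
     (\<forall>x\<in>state_set M. \<forall>s\<ge>0. \<forall>t\<ge>0. flow M x (s + t) = flow M (flow M x s) t) \<and>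
     (\<lambda>(x, a). jump M x a) \<in>
       restrict_space borel (state_set M \<times> impulse_set M) \<rightarrow>\<^sub>M restrict_space borel (state_set M) \<and>
     0 < discount M \<and>
     (\<forall>j\<le>ncons M. run_cost M j \<in> borel_measurable (restrict_space borel (state_set M))) \<and>
     (\<forall>j\<le>ncons M. (\<lambda>(x, a). imp_cost M j x a) \<in>
       borel_measurable (restrict_space borel (state_set M \<times> impulse_set M))) \<and>
     (\<forall>j\<in>{1..ncons M}. 0 \<le> bound M j)"

definition xdelta :: "('x, 'a) impulse_model \<Rightarrow> 'x option set" where
  "xdelta M = insert None (Some ` state_set M)"

text \<open>The order topology on \<^typ>\<open>ennreal\<close> is the one-point compactification of $[0,\infty)$.\<close>

definition acts :: "('x, 'a) impulse_model \<Rightarrow> (ennreal \<times> 'a) set" where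
  "acts M = UNIV \<times> impulse_set M"

definition state_alg :: "('x::topological_space, 'a) impulse_model \<Rightarrow> 'x option measure" where
  "state_alg M = restrict_space borel (xdelta M)"

definition act_alg :: "('x, 'a::topological_space) impulse_model \<Rightarrow> (ennreal \<times> 'a) measure" where
  "act_alg M = restrict_space borel (acts M)"

definition trans_kernel :: "('x::topological_space, 'a) impulse_model \<Rightarrow>
    'x option \<Rightarrow> ennreal \<times> 'a \<Rightarrow> 'x option measure" where
  "trans_kernel M x b = (case (x, b) of
       (Some y, (\<theta>, a)) \<Rightarrow>
         (if \<theta> = \<infinity> then return (state_alg M) None
          else let p = exp (- discount M * enn2real \<theta>) in
            measure_of (xdelta M) (sets (state_alg M))
              (\<lambda>\<Gamma>. ennreal p * indicator \<Gamma> (Some (jump M (flow M y (enn2real \<theta>)) a))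
                 + ennreal (1 - p) * indicator \<Gamma> None))
     | (None, _) \<Rightarrow> return (state_alg M) None)"

definition cost :: "('x, 'a) impulse_model \<Rightarrow> nat \<Rightarrow> 'x option \<Rightarrow> ennreal \<times> 'a \<Rightarrow> ennreal" where
  "cost M j x b = (case (x, b) of
       (Some y, (\<theta>, a)) \<Rightarrow>
         (\<integral>\<^sup>+t\<in>{t. 0 \<le> t \<and> ennreal t \<le> \<theta>}.
            ennreal (exp (- discount M * t)) * run_cost M j (flow M y t) \<partial>lborel)
         + (if \<theta> = \<infinity> then 0
            else ennreal (exp (- discount M * enn2real \<theta>)) *
                 imp_cost M j (flow M y (enn2real \<theta>)) a)
     | (None, _) \<Rightarrow> 0)"

text \<open>
  A trajectory $(x_0, b_1, x_1, b_2, \dots)$ is the function $n \mapsto (x_n, b_{n+1})$. A history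
  $(x_0, b_1, \dots, b_n, x_n)$ is the pair of its first \<^term>\<open>n\<close> coordinates and $x_n$, and
  \<^term>\<open>\<pi> n\<close> is the kernel $\pi_{n+1}(db \mid h_n)$.
\<close>

type_synonym ('x, 'a) traj = "nat \<Rightarrow> 'x option \<times> ennreal \<times> 'a"
type_synonym ('x, 'a) strategy = "nat \<Rightarrow> ('x, 'a) traj \<times> 'x option \<Rightarrow> (ennreal \<times> 'a) measure"

definition pair_alg :: "('x::topological_space, 'a::topological_space) impulse_model \<Rightarrow>
    ('x option \<times> ennreal \<times> 'a) measure" where
  "pair_alg M = state_alg M \<Otimes>\<^sub>M act_alg M"

definition strategies :: "('x::topological_space, 'a::topological_space) impulse_model \<Rightarrow>
    ('x, 'a) strategy set" where
  "strategies M =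
     {\<pi>. \<forall>n. \<pi> n \<in> PiM {0..<n} (\<lambda>_. pair_alg M) \<Otimes>\<^sub>M state_alg M \<rightarrow>\<^sub>M prob_algebra (act_alg M)}"

text \<open>The conditional law of $(X_n, B_{n+1})$ given the previous pairs.\<close>

definition step_kernel :: "('x::topological_space, 'a::topological_space) impulse_model \<Rightarrow>
    'x option \<Rightarrow> ('x, 'a) strategy \<Rightarrow> nat \<Rightarrow> ('x, 'a) traj \<Rightarrow> ('x option \<times> ennreal \<times> 'a) measure" where
  "step_kernel M x \<pi> n \<omega> =
     (case n of 0 \<Rightarrow> return (state_alg M) x | Suc m \<Rightarrow> trans_kernel M (fst (\<omega> m)) (snd (\<omega> m)))
     \<bind> (\<lambda>y. distr (\<pi> n (\<omega>, y)) (pair_alg M) (Pair y))"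

definition path_measure :: "('x::topological_space, 'a::topological_space) impulse_model \<Rightarrow>
    'x option \<Rightarrow> ('x, 'a) strategy \<Rightarrow> ('x, 'a) traj measure" where
  "path_measure M x \<pi> =
     projective_family.lim UNIV (Ionescu_Tulcea.CI (step_kernel M x \<pi>) (\<lambda>_. pair_alg M)) (\<lambda>_. pair_alg M)"

text \<open>
  Outside the locale \<^locale>\<open>Ionescu_Tulcea\<close> its constants are meaningful only where the
  locale assumptions hold. The following lemmas verify these for every valid model, initial state
  and strategy, and that the formula in \<^const>\<open>trans_kernel\<close> defines a probability measure.
\<close>

lemma space_state_alg: "space (state_alg M) = xdelta M" by (simp add: state_alg_def space_restrict_space)
lemma space_act_alg: "space (act_alg M) = acts M" by (simp add: act_alg_def space_restrict_space)

lemma flow_in: assumes M: "valid_model M" "y \<in> state_set M" "0 \<le> t" shows "flow M y t \<in> state_set M"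
proof -
  have f: "(y, t) \<in> space (restrict_space borel (state_set M \<times> {0..}))"
    using assms by (simp add: space_restrict_space)
  show ?thesis
    using measurable_space[OF _ f, of "\<lambda>(x,t). flow M x t" "restrict_space borel (state_set M)"] M
    by (simp add: valid_model_def space_restrict_space)
qed

lemma jump_in: assumes M: "valid_model M" "y \<in> state_set M" "a \<in> impulse_set M" shows "jump M y a \<in> state_set M"
proof -
  have f: "(y, a) \<in> space (restrict_space borel (state_set M \<times> impulse_set M))"
    using assms by (simp add: space_restrict_space)
  show ?thesis
    using measurable_space[OF _ f, of "\<lambda>(x,t). jump M x t" "restrict_space borel (state_set M)"] M
    by (simp add: valid_model_def space_restrict_space)
qed

lemma trans_kernel_emeasure:
  assumes M: "valid_model M" and y: "y \<in> state_set M" and a: "a \<in> impulse_set M" and \<theta>: "\<theta> \<noteq> \<infinity>"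
  defines "p \<equiv> exp (- discount M * enn2real \<theta>)"
    and "z \<equiv> jump M (flow M y (enn2real \<theta>)) a"
  shows "prob_space (trans_kernel M (Some y) (\<theta>, a)) \<and> sets (trans_kernel M (Some y) (\<theta>, a)) = sets (state_alg M) \<and>
   (\<forall>\<Gamma>\<in>sets (state_alg M). emeasure (trans_kernel M (Some y) (\<theta>, a)) \<Gamma> = ennreal p * indicator \<Gamma> (Some z) + ennreal (1 - p) * indicator \<Gamma> None)"
proof -
  have jz: "z \<in> state_set M" unfolding z_def by (intro jump_in flow_in M y a) auto
  have p: "0 \<le> p" "p \<le> 1" using M by (auto simp: valid_model_def p_def)
  let ?f = "\<lambda>c. if c then Some z else None"
  let ?D = "distr (measure_pmf (bernoulli_pmf p)) (state_alg M) ?f"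
  have meas: "?f \<in> measure_pmf (bernoulli_pmf p) \<rightarrow>\<^sub>M state_alg M"
    using jz by (auto simp: space_state_alg xdelta_def)
  have eq: "emeasure ?D \<Gamma> = ennreal p * indicator \<Gamma> (Some z) + ennreal (1 - p) * indicator \<Gamma> None"
    if "\<Gamma> \<in> sets (state_alg M)" for \<Gamma>
  proof -
    have "emeasure ?D \<Gamma> = (\<integral>\<^sup>+ x. indicator \<Gamma> x \<partial>?D)" using that by simp
    also have "\<dots> = (\<integral>\<^sup>+ c. indicator \<Gamma> (?f c) \<partial>measure_pmf (bernoulli_pmf p))"
      by (rule nn_integral_distr[OF meas]) (use that in simp)
    also have "\<dots> = ennreal p * indicator \<Gamma> (Some z) + ennreal (1 - p) * indicator \<Gamma> None"
      using p by (simp add: mult.commute)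
    finally show ?thesis .
  qed
  have "?D = measure_of (space ?D) (sets ?D) (emeasure ?D)"
    by (simp only: measure_of_of_measure)
  also have "\<dots> = trans_kernel M (Some y) (\<theta>, a)"
    unfolding trans_kernel_def using \<theta>
    apply (simp add: Let_def space_state_alg flip: p_def z_def)
    apply (rule measure_of_eq)
    using sets.space_closed[of "state_alg M"]
    apply (simp add: space_state_alg)
    apply (subst (asm) sets.sigma_sets_eq[of "state_alg M", unfolded space_state_alg])
    apply (simp only: eq)
    apply (simp add: p_def)
    done
  finally have *: "trans_kernel M (Some y) (\<theta>, a) = ?D" ..
  show ?thesis unfolding * using eq measure_pmf.prob_space_distr[OF meas] by simp
qed

lemma strategies_nonempty:
  assumes M: "valid_model M"
  shows "strategies M \<noteq> {}"
proof -
  obtain a where a: "a \<in> impulse_set M" using M by (auto simp: valid_model_def)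
  have "(\<lambda>n h. return (act_alg M) (0,a)) \<in> strategies M"
    using a by (auto simp: strategies_def space_prob_algebra space_act_alg acts_def intro!: measurable_const prob_space_return)
  then show ?thesis by auto
qed

lemma borel_option_None[simp]: "{None} \<in> sets (borel :: 'a::topological_space option measure)"
  by (intro borel_open) (auto simp: open_option_def vimage_def)

lemma Some_meas: "Some \<in> borel \<rightarrow>\<^sub>M borel"
  by (rule borel_measurableI) (auto simp: open_option_def)

lemma measurable_trans_kernel:
  fixes M :: "('x::polish_space, 'a::polish_space) impulse_model"
  assumes M: "valid_model M"
  shows "(\<lambda>(x,b). trans_kernel M x b) \<in> state_alg M \<Otimes>\<^sub>M act_alg M \<rightarrow>\<^sub>M prob_algebra (state_alg M)"
proof -
  obtain xx where xx: "xx \<in> state_set M" using M by (auto simp: valid_model_def)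
  define dec where "dec x = (case x of None \<Rightarrow> xx | Some y \<Rightarrow> y)" for x
  let ?X = "restrict_space borel (state_set M)"
  have "dec \<in> borel \<rightarrow>\<^sub>M borel"
  proof (rule borel_measurableI)
    fix S :: "'x set" assume "open S"
    have "dec -` S \<inter> space borel = Some ` S \<union> (if xx \<in> S then {None} else {})"
      by (auto simp: dec_def image_iff split: option.splits)
    moreover have "open (Some ` S)" using \<open>open S\<close> by (simp add: open_option_def inj_vimage_image_eq)
    ultimately show "dec -` S \<inter> space borel \<in> sets borel"
      by (simp only:) (intro sets.Un; simp del: insert_iff split: if_split)
  qed
  then have dec[measurable]: "dec \<in> state_alg M \<rightarrow>\<^sub>M ?X"
    unfolding state_alg_def by (rule measurable_restrict_space3) (auto simp: xdelta_def dec_def xx)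
  have fst0: "fst \<in> act_alg M \<rightarrow>\<^sub>M borel" and snd0: "snd \<in> act_alg M \<rightarrow>\<^sub>M borel"
    unfolding act_alg_def by (intro measurable_restrict_space1 borel_measurable_continuous_onI continuous_intros)+
  note [measurable] = fst0 snd0
  have dec0[measurable]: "dec \<in> state_alg M \<rightarrow>\<^sub>M borel"
    using dec by (simp add: measurable_restrict_space2_iff)
  let ?P = "state_alg M \<Otimes>\<^sub>M act_alg M"
  have f1: "(\<lambda>w. (dec (fst w), enn2real (fst (snd w)))) \<in> ?P \<rightarrow>\<^sub>M restrict_space borel (state_set M \<times> {0..})"
    by (rule measurable_restrict_space2)
       (use measurable_space[OF dec] in \<open>auto simp: space_pair_measure space_restrict_space\<close>)
  have fl: "(\<lambda>w. flow M (dec (fst w)) (enn2real (fst (snd w)))) \<in> ?P \<rightarrow>\<^sub>M ?X"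
    using measurable_compose[OF f1, of "\<lambda>(x,t). flow M x t" ?X] M by (simp add: valid_model_def)
  then have fl0[measurable]: "(\<lambda>w. flow M (dec (fst w)) (enn2real (fst (snd w)))) \<in> ?P \<rightarrow>\<^sub>M borel"
    and fl1: "\<And>w. w \<in> space ?P \<Longrightarrow> flow M (dec (fst w)) (enn2real (fst (snd w))) \<in> state_set M"
    by (auto simp: measurable_restrict_space2_iff dest: measurable_space)
  have f2: "(\<lambda>w. (flow M (dec (fst w)) (enn2real (fst (snd w))), snd (snd w))) \<in> ?P \<rightarrow>\<^sub>M restrict_space borel (state_set M \<times> impulse_set M)"
    by (rule measurable_restrict_space2)
       (use fl1 in \<open>auto simp: space_pair_measure space_act_alg acts_def\<close>)
  define z where "z w = jump M (flow M (dec (fst w)) (enn2real (fst (snd w)))) (snd (snd w))" for w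
  have z: "z \<in> ?P \<rightarrow>\<^sub>M ?X" unfolding z_def
    using measurable_compose[OF f2, of "\<lambda>(x,t). jump M x t" ?X] M by (simp add: valid_model_def)
  have S: "(\<lambda>w. Some (z w)) \<in> ?P \<rightarrow>\<^sub>M state_alg M"
    unfolding state_alg_def
    apply (rule measurable_restrict_space2)
    subgoal using measurable_space[OF z] by (auto simp: xdelta_def space_restrict_space state_alg_def)
    subgoal using z by (intro measurable_compose[OF _ Some_meas]) (simp add: measurable_restrict_space2_iff state_alg_def)
    done
  note [measurable] = S
  have [simp]: "None \<in> space (state_alg M)" by (simp add: space_state_alg xdelta_def)
  have N[measurable]: "{None} \<in> sets (state_alg M)"
    unfolding state_alg_def sets_restrict_space
    by (rule image_eqI[of _ _ "{None}"]) (auto simp: xdelta_def)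
  define p where "p w = exp (- discount M * enn2real (fst (snd w)))" for w :: "'x option \<times> ennreal \<times> 'a"
  have [measurable]: "p \<in> borel_measurable ?P" unfolding p_def by measurable
  have desc: "prob_space (trans_kernel M (fst w) (snd w)) \<and> sets (trans_kernel M (fst w) (snd w)) = sets (state_alg M) \<and>
    (\<forall>\<Gamma>\<in>sets (state_alg M). emeasure (trans_kernel M (fst w) (snd w)) \<Gamma> =
       (if fst w \<in> {None} \<or> fst (snd w) = \<infinity> then indicator \<Gamma> None
        else ennreal (p w) * indicator \<Gamma> (Some (z w)) + ennreal (1 - p w) * indicator \<Gamma> None))"
    if w: "w \<in> space ?P" for w
  proof (cases "fst w = None \<or> fst (snd w) = \<infinity>")
    case True
    then have "trans_kernel M (fst w) (snd w) = return (state_alg M) None"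
      by (cases w) (auto simp: trans_kernel_def split: option.splits)
    then show ?thesis using True by (auto intro!: prob_space_return)
  next
    case False
    then obtain y \<theta> a where e: "w = (Some y, \<theta>, a)" "\<theta> \<noteq> \<infinity>" by (cases w) auto
    have "y \<in> state_set M" "a \<in> impulse_set M" using w e by (auto simp: space_pair_measure space_state_alg xdelta_def space_act_alg acts_def)
    from trans_kernel_emeasure[OF M this e(2)] show ?thesis using e by (simp add: p_def z_def dec_def)
  qed
  show ?thesis
    unfolding split_beta'
  proof (rule measurable_prob_algebraI)
    show "prob_space (trans_kernel M (fst w) (snd w))" if "w \<in> space ?P" for w using desc[OF that] by blast
    show "(\<lambda>w. trans_kernel M (fst w) (snd w)) \<in> ?P \<rightarrow>\<^sub>M subprob_algebra (state_alg M)"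
    proof (rule measurable_subprob_algebra)
      fix w assume "w \<in> space ?P"
      then show "subprob_space (trans_kernel M (fst w) (snd w))" "sets (trans_kernel M (fst w) (snd w)) = sets (state_alg M)"
        using desc[of w] prob_space_imp_subprob_space by blast+
    next
      fix \<Gamma> assume [measurable]: "\<Gamma> \<in> sets (state_alg M)"
      have "(\<lambda>w. if fst w \<in> {None} \<or> fst (snd w) = \<infinity> then indicator \<Gamma> None
        else ennreal (p w) * indicator \<Gamma> (Some (z w)) + ennreal (1 - p w) * indicator \<Gamma> None :: ennreal) \<in> borel_measurable ?P"
      proof -
        have 1: "(\<lambda>w. indicator \<Gamma> (Some (z w)) :: ennreal) \<in> borel_measurable ?P"
          by (rule measurable_compose[OF S borel_measurable_indicator]) fact
        have 2: "{w \<in> space ?P. fst w \<in> {None} \<or> fst (snd w) = \<infinity>} \<in> sets ?P"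
          by measurable
        have 3: "p \<in> borel_measurable ?P" by fact
        show ?thesis
          apply (rule measurable_If)
            apply (rule borel_measurable_const)
           apply (intro borel_measurable_add borel_measurable_times_ennreal 1 
             measurable_compose[OF _ measurable_ennreal] borel_measurable_diff 3 borel_measurable_const)
          apply (rule 2)
          done
      qed
      note F = this
      have E: "\<And>w. w \<in> space ?P \<Longrightarrow> emeasure (trans_kernel M (fst w) (snd w)) \<Gamma> = (if fst w \<in> {None} \<or> fst (snd w) = \<infinity> then indicator \<Gamma> None
        else ennreal (p w) * indicator \<Gamma> (Some (z w)) + ennreal (1 - p w) * indicator \<Gamma> None :: ennreal)"
        by (rule bspec[OF conjunct2[OF conjunct2[OF desc]]]) (assumption, rule \<open>\<Gamma> \<in> sets (state_alg M)\<close>)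
      show "(\<lambda>w. emeasure (trans_kernel M (fst w) (snd w)) \<Gamma>) \<in> borel_measurable ?P"
        by (rule iffD2[OF measurable_cong F], rule E)
    qed
  qed
qed

lemma Ionescu_Tulcea_step_kernel:
  fixes M :: "('x::polish_space, 'a::polish_space) impulse_model"
  assumes M: "valid_model M" and x: "x \<in> xdelta M" and \<pi>: "\<pi> \<in> strategies M"
  shows "Ionescu_Tulcea (step_kernel M x \<pi>) (\<lambda>_. pair_alg M)"
proof -
  have pi: "\<pi> n \<in> PiM {0..<n} (\<lambda>_. pair_alg M) \<Otimes>\<^sub>M state_alg M \<rightarrow>\<^sub>M prob_algebra (act_alg M)" for n
    using \<pi> by (auto simp: strategies_def)
  have step: "step_kernel M x \<pi> n \<in> PiM {0..<n} (\<lambda>_. pair_alg M) \<rightarrow>\<^sub>M prob_algebra (pair_alg M)" for n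
    unfolding step_kernel_def
  proof (rule measurable_bind_prob_space2)
    show "(\<lambda>\<omega>. case n of 0 \<Rightarrow> return (state_alg M) x | Suc m \<Rightarrow> trans_kernel M (fst (\<omega> m)) (snd (\<omega> m)))
      \<in> PiM {0..<n} (\<lambda>_. pair_alg M) \<rightarrow>\<^sub>M prob_algebra (state_alg M)"
    proof (cases n)
      case 0 then show ?thesis using x by (auto simp: space_prob_algebra space_state_alg intro!: prob_space_return)
    next
      case (Suc m)
      have "(\<lambda>\<omega>. \<omega> m) \<in> PiM {0..<n} (\<lambda>_. pair_alg M) \<rightarrow>\<^sub>M state_alg M \<Otimes>\<^sub>M act_alg M"
        using Suc measurable_component_singleton[of m "{0..<n}" "\<lambda>_. pair_alg M"] by (simp add: pair_alg_def)
      from measurable_compose[OF this measurable_trans_kernel[OF M]] Suc show ?thesis by (simp add: split_beta')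
    qed
    show "(\<lambda>(\<omega>, y). distr (\<pi> n (\<omega>, y)) (pair_alg M) (Pair y))
      \<in> PiM {0..<n} (\<lambda>_. pair_alg M) \<Otimes>\<^sub>M state_alg M \<rightarrow>\<^sub>M prob_algebra (pair_alg M)"
      unfolding split_beta'
      by (rule measurable_distr_prob_space2[where M="act_alg M"]) (use pi[of n] in \<open>simp_all add: pair_alg_def\<close>)
  qed
  show ?thesis
  proof (rule Ionescu_Tulcea.intro)
    fix n \<omega>
    show "step_kernel M x \<pi> n \<in> PiM {0..<n} (\<lambda>_. pair_alg M) \<rightarrow>\<^sub>M subprob_algebra (pair_alg M)"
      by (rule measurable_prob_algebraD[OF step])
    assume "\<omega> \<in> space (PiM {0..<n} (\<lambda>_. pair_alg M))"
    from measurable_space[OF step this] show "prob_space (step_kernel M x \<pi> n \<omega>)"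
      by (simp add: space_prob_algebra)
  qed
qed

definition value_of :: "('x::topological_space, 'a::topological_space) impulse_model \<Rightarrow>
    'x option \<Rightarrow> ('x, 'a) strategy \<Rightarrow> ('x option \<Rightarrow> ennreal \<times> 'a \<Rightarrow> ennreal) \<Rightarrow> ennreal" where
  "value_of M x \<pi> c = (\<integral>\<^sup>+\<omega>. (\<Sum>i. c (fst (\<omega> i)) (snd (\<omega> i))) \<partial>path_measure M x \<pi>)"

definition total_cost :: "('x, 'a) impulse_model \<Rightarrow> 'x option \<Rightarrow> ennreal \<times> 'a \<Rightarrow> ennreal" where
  "total_cost M x b = (\<Sum>j\<le>ncons M. cost M j x b)"

definition semicontinuous_mdp :: "('x::topological_space, 'a::topological_space) impulse_model \<Rightarrow> bool" where
  "semicontinuous_mdp M \<longleftrightarrow>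
     compact (acts M) \<and>
     (\<forall>u :: 'x option \<Rightarrow> real. continuous_on (xdelta M) u \<and> bounded (u ` xdelta M) \<longrightarrow>
        continuous_on (xdelta M \<times> acts M) (\<lambda>(x, b). \<integral>y. u y \<partial>trans_kernel M x b)) \<and>
     (\<forall>j\<le>ncons M. lsc_on (xdelta M \<times> acts M) (\<lambda>(x, b). cost M j x b))"

definition vset :: "('x::topological_space, 'a::topological_space) impulse_model \<Rightarrow> 'x option set" where
  "vset M = {x \<in> xdelta M. (INF \<pi>\<in>strategies M. value_of M x \<pi> (total_cost M)) > 0}"

definition vset_alg :: "('x::topological_space, 'a::topological_space) impulse_model \<Rightarrow>
    'x option measure" where
  "vset_alg M = restrict_space borel (vset M)"

definition occ_measures :: "('x::topological_space, 'a::topological_space) impulse_model \<Rightarrow>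
    'x option \<Rightarrow> ('x option \<times> ennreal \<times> 'a) measure set" where
  "occ_measures M x0 =
     {\<mu>. sets \<mu> = sets (vset_alg M \<Otimes>\<^sub>M act_alg M) \<and>
         sigma_finite_measure (distr \<mu> (vset_alg M) fst) \<and>
         (\<forall>\<Gamma>\<in>sets (vset_alg M).
            emeasure \<mu> (\<Gamma> \<times> acts M) =
              indicator \<Gamma> x0 + (\<integral>\<^sup>+(y, b). emeasure (trans_kernel M y b) \<Gamma> \<partial>\<mu>)) \<and>
         (\<integral>\<^sup>+(x, b). total_cost M x b \<partial>\<mu>) < \<infinity>}"

definition int_cost :: "('x, 'a) impulse_model \<Rightarrow> nat \<Rightarrow>
    ('x option \<times> ennreal \<times> 'a) measure \<Rightarrow> ennreal" where
  "int_cost M j \<mu> = (\<integral>\<^sup>+(x, b). cost M j x b \<partial>\<mu>)"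

text \<open>All \<^term>\<open>int_cost M j \<mu>\<close> are finite for \<^term>\<open>\<mu> \<in> occ_measures M x0\<close>, so
  \<^const>\<open>enn2real\<close> loses nothing there.\<close>

definition lagrangian :: "('x, 'a) impulse_model \<Rightarrow>
    ('x option \<times> ennreal \<times> 'a) measure \<Rightarrow> (nat \<Rightarrow> real) \<Rightarrow> real" where
  "lagrangian M \<mu> g =
     enn2real (int_cost M 0 \<mu>) +
     (\<Sum>j\<in>{1..ncons M}. g j * (enn2real (int_cost M j \<mu>) - bound M j))"

definition multipliers :: "('x, 'a) impulse_model \<Rightarrow> (nat \<Rightarrow> real) set" where
  "multipliers M = PiE {1..ncons M} (\<lambda>_. {0..})"

definition primal_fun :: "('x, 'a) impulse_model \<Rightarrow>
    ('x option \<times> ennreal \<times> 'a) measure \<Rightarrow> ereal" where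
  "primal_fun M \<mu> = (SUP g\<in>multipliers M. ereal (lagrangian M \<mu> g))"

definition dual_fun :: "('x::topological_space, 'a::topological_space) impulse_model \<Rightarrow>
    'x option \<Rightarrow> (nat \<Rightarrow> real) \<Rightarrow> ereal" where
  "dual_fun M x0 g = (INF \<mu>\<in>occ_measures M x0. ereal (lagrangian M \<mu> g))"

end

theory Submission
  imports Defs
begin

text \<open>
  The theorem is Lagrangian duality for a convex program with finitely many constraints. Its
  feasible domain \<^term>\<open>occ_measures M x0\<close> is convex, because the characteristic equation, the
  \<open>\<sigma>\<close>-finiteness of the marginal and the finiteness of the total cost all survive convex
  combinations of measures (\<open>occ_measures_mix\<close>), and every \<^term>\<open>int_cost M j \<mu>\<close> is affine
  in the measure. The rest concerns only the real numbers
  $f(\mu) = \int \bar C_0\,d\mu$ and $h_j(\mu) = \int \bar C_j\,d\mu - d_j$.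

  The heart is the existence of multipliers at which the Lagrangian stays above the primal value
  (\<open>lagrange_multipliers\<close>). Separation of convex sets in $\mathbb R^{J+1}$ would give
  them, but the constraints can also be dualized one at a time. With a single
  constraint $h \le 0$ a multiplier is a slope $g \ge 0$ separating the points
  $(h(\mu), f(\mu))$ with $h(\mu) > 0$ from those with $h(\mu) < 0$; if no slope separated a pair
  of such points, the chord between them would cross $h = 0$ below the primal value. The Slater
  point bounds from above the slopes that the former points require, so their supremum is a
  multiplier. With several constraints, one of
  them is dualized on the domain cut out by the others, its term joins the objective,
  and induction applies.

  Such multipliers have dual value at least the primal value; weak duality makes this an equality,
  so the dual problem is solved. The optimality conditions then follow easily: the supremum of the Lagrangian over
  the multipliers is $f(\mu)$ at a feasible $\mu$, and a pair is optimal precisely when it closes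
  the gap between the two sides of weak duality.
\<close>

section \<open>Linear combinations of measures\<close>

definition lincomb_measure :: "ennreal \<Rightarrow> ennreal \<Rightarrow> 'a measure \<Rightarrow> 'a measure \<Rightarrow> 'a measure" where
  "lincomb_measure a b \<mu> \<nu> =
     measure_of (space \<mu>) (sets \<mu>) (\<lambda>A. a * emeasure \<mu> A + b * emeasure \<nu> A)"

lemma space_lincomb_measure[simp]: "space (lincomb_measure a b \<mu> \<nu>) = space \<mu>"
  by (simp add: lincomb_measure_def)

lemma sets_lincomb_measure[simp]: "sets (lincomb_measure a b \<mu> \<nu>) = sets \<mu>"
  by (simp add: lincomb_measure_def)

lemma emeasure_lincomb_measure:
  assumes "sets \<nu> = sets \<mu>"
  shows "emeasure (lincomb_measure a b \<mu> \<nu>) A = a * emeasure \<mu> A + b * emeasure \<nu> A"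
proof (cases "A \<in> sets \<mu>")
  case True
  show ?thesis
  proof (rule emeasure_measure_of[OF lincomb_measure_def sets.space_closed])
    show "positive (sets (lincomb_measure a b \<mu> \<nu>)) (\<lambda>A. a * emeasure \<mu> A + b * emeasure \<nu> A)"
      by (simp add: positive_def)
    show "countably_additive (sets (lincomb_measure a b \<mu> \<nu>))
        (\<lambda>A. a * emeasure \<mu> A + b * emeasure \<nu> A)"
    proof (rule countably_additiveI)
      fix F :: "nat \<Rightarrow> 'a set"
      assume F: "range F \<subseteq> sets (lincomb_measure a b \<mu> \<nu>)" "disjoint_family F"
      have "(\<Sum>i. emeasure \<mu> (F i)) = emeasure \<mu> (\<Union>i. F i)"
        "(\<Sum>i. emeasure \<nu> (F i)) = emeasure \<nu> (\<Union>i. F i)"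
        using F assms by (auto intro!: suminf_emeasure)
      then show "(\<Sum>i. a * emeasure \<mu> (F i) + b * emeasure \<nu> (F i)) =
          a * emeasure \<mu> (\<Union>i. F i) + b * emeasure \<nu> (\<Union>i. F i)"
        by (simp add: suminf_add[symmetric])
    qed
    show "A \<in> sets (lincomb_measure a b \<mu> \<nu>)" using True by simp
  qed
next
  case False
  then show ?thesis using assms by (simp add: emeasure_notin_sets)
qed

text \<open>
  \<^const>\<open>nn_integral\<close> is the supremum of the integrals of simple minorants, which are additive in the
  measure, and a minorant that is good for \<^term>\<open>\<mu>\<close> and one that is good for \<^term>\<open>\<nu>\<close> are both
  improved by their pointwise maximum. The lemma covers non-measurable integrands because
  occupation measures live on \<^term>\<open>vset M\<close>, which is defined by an infimum over strategies and is
  not evidently Borel; for such a set \<^term>\<open>\<lambda>(y, b). emeasure (trans_kernel M y b) \<Gamma>\<close> need not be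
  measurable.
\<close>

lemma nn_integral_lincomb_measure:
  fixes f :: "'a \<Rightarrow> ennreal"
  assumes sets: "sets \<nu> = sets \<mu>"
  shows "(\<integral>\<^sup>+x. f x \<partial>lincomb_measure a b \<mu> \<nu>) = a * (\<integral>\<^sup>+x. f x \<partial>\<mu>) + b * (\<integral>\<^sup>+x. f x \<partial>\<nu>)"
    (is "?L = ?R")
proof -
  let ?\<rho> = "lincomb_measure a b \<mu> \<nu>"
  have space: "space \<nu> = space \<mu>" using sets by (rule sets_eq_imp_space_eq)
  have simple_eq: "simple_function ?\<rho> g = simple_function \<mu> g"
    "simple_function \<nu> g = simple_function \<mu> g" for g :: "'a \<Rightarrow> ennreal"
    by (simp_all add: simple_function_def space sets)
  have simple_int: "integral\<^sup>S ?\<rho> g = a * integral\<^sup>S \<mu> g + b * integral\<^sup>S \<nu> g"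
    for g :: "'a \<Rightarrow> ennreal"
    by (simp add: simple_integral_def space emeasure_lincomb_measure[OF sets] sum_distrib_left
        distrib_left sum.distrib mult.left_commute)
  let ?G = "{g. simple_function \<mu> g \<and> g \<le> f}"
  have directed: "\<exists>m\<in>?G. a * integral\<^sup>S \<mu> g + b * integral\<^sup>S \<nu> g' \<le>
      a * integral\<^sup>S \<mu> m + b * integral\<^sup>S \<nu> m" if "g \<in> ?G" "g' \<in> ?G" for g g'
    using that simple_eq
    by (intro bexI[of _ "\<lambda>x. max (g x) (g' x)"] add_mono mult_left_mono simple_integral_mono)
      (auto simp: le_fun_def)
  have "?R = (SUP g\<in>?G. a * integral\<^sup>S \<mu> g) + (SUP g\<in>?G. b * integral\<^sup>S \<nu> g)"
    by (simp add: nn_integral_def SUP_mult_left_ennreal simple_eq)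
  also have "\<dots> = (SUP g\<in>?G. integral\<^sup>S ?\<rho> g)"
    unfolding simple_int by (rule SUP_add_directed_ennreal[symmetric]) (rule directed)
  also have "\<dots> = ?L"
    by (simp add: nn_integral_def simple_eq)
  finally show ?thesis ..
qed

lemma sigma_finite_lincomb_measure:
  assumes "sigma_finite_measure \<mu>" "sigma_finite_measure \<nu>"
    and sets: "sets \<nu> = sets \<mu>" and fin: "a < \<infinity>" "b < \<infinity>"
  shows "sigma_finite_measure (lincomb_measure a b \<mu> \<nu>)"
proof -
  obtain A where A: "countable A" "A \<subseteq> sets \<mu>" "\<Union>A = space \<mu>" "\<forall>X\<in>A. emeasure \<mu> X \<noteq> \<infinity>"
    using assms(1) by (auto simp: sigma_finite_measure_def)
  obtain B where B: "countable B" "B \<subseteq> sets \<nu>" "\<Union>B = space \<nu>" "\<forall>X\<in>B. emeasure \<nu> X \<noteq> \<infinity>"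
    using assms(2) by (auto simp: sigma_finite_measure_def)
  define C where "C = (\<lambda>(X, Y). X \<inter> Y) ` (A \<times> B)"
  have "countable C" using A B by (auto simp: C_def)
  moreover have "C \<subseteq> sets \<mu>" using A B sets by (auto simp: C_def)
  moreover have "\<Union>C = space \<mu>"
  proof -
    have "\<Union>C = \<Union>A \<inter> \<Union>B" unfolding C_def by blast
    then show ?thesis using A(3) B(3) sets_eq_imp_space_eq[OF sets] by simp
  qed
  moreover have "emeasure (lincomb_measure a b \<mu> \<nu>) Z \<noteq> \<infinity>" if "Z \<in> C" for Z
  proof -
    obtain X Y where Z: "X \<in> A" "Y \<in> B" "Z = X \<inter> Y"
      using \<open>Z \<in> C\<close> unfolding C_def by blast
    have "emeasure \<mu> Z \<le> emeasure \<mu> X" "emeasure \<nu> Z \<le> emeasure \<nu> Y"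
      using Z A B by (auto intro!: emeasure_mono)
    then have "emeasure \<mu> Z < \<infinity>" "emeasure \<nu> Z < \<infinity>"
      using Z A B by (auto simp: less_top[symmetric] top_unique)
    then show ?thesis
      using fin by (simp add: emeasure_lincomb_measure[OF sets] ennreal_mult_eq_top_iff less_top)
  qed
  ultimately show ?thesis
    unfolding sigma_finite_measure_def by (intro exI[of _ C]) auto
qed

section \<open>Convexity of the set of occupation measures\<close>

text \<open>
  The weights must sum to one: the characteristic equation is only affine in the measure, with the
  source term $\delta_{x_0}$.
\<close>

lemma occ_measures_mix:
  assumes \<mu>: "\<mu> \<in> occ_measures M x0" and \<nu>: "\<nu> \<in> occ_measures M x0"
    and t: "0 \<le> t" "t \<le> (1::real)"
  shows "lincomb_measure (ennreal t) (ennreal (1 - t)) \<mu> \<nu> \<in> occ_measures M x0"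
proof -
  let ?\<rho> = "lincomb_measure (ennreal t) (ennreal (1 - t)) \<mu> \<nu>"
  let ?V = "vset_alg M" and ?A = "act_alg M"
  have s\<mu>: "sets \<mu> = sets (?V \<Otimes>\<^sub>M ?A)" and s\<nu>: "sets \<nu> = sets (?V \<Otimes>\<^sub>M ?A)"
    using \<mu> \<nu> by (auto simp: occ_measures_def)
  have sets: "sets \<nu> = sets \<mu>" using s\<mu> s\<nu> by simp
  have space: "space \<nu> = space \<mu>" using sets by (rule sets_eq_imp_space_eq)
  have fst: "fst \<in> \<mu> \<rightarrow>\<^sub>M ?V" "fst \<in> \<nu> \<rightarrow>\<^sub>M ?V" "fst \<in> ?\<rho> \<rightarrow>\<^sub>M ?V"
    using s\<mu> s\<nu> by (simp_all cong: measurable_cong_sets)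
  have weights: "ennreal t + ennreal (1 - t) = 1"
    using t by (simp flip: ennreal_plus)
  have marginal: "distr ?\<rho> ?V fst =
      lincomb_measure (ennreal t) (ennreal (1 - t)) (distr \<mu> ?V fst) (distr \<nu> ?V fst)"
    by (rule measure_eqI)
      (auto simp: emeasure_distr fst emeasure_lincomb_measure sets space)
  have "sigma_finite_measure (distr ?\<rho> ?V fst)"
    unfolding marginal using \<mu> \<nu>
    by (intro sigma_finite_lincomb_measure) (auto simp: occ_measures_def)
  moreover have "emeasure ?\<rho> (\<Gamma> \<times> acts M) =
      indicator \<Gamma> x0 + (\<integral>\<^sup>+(y, b). emeasure (trans_kernel M y b) \<Gamma> \<partial>?\<rho>)"
    if \<Gamma>: "\<Gamma> \<in> sets ?V" for \<Gamma>
  proof -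
    let ?I = "\<lambda>\<mu>. \<integral>\<^sup>+(y, b). emeasure (trans_kernel M y b) \<Gamma> \<partial>\<mu>"
    have "emeasure ?\<rho> (\<Gamma> \<times> acts M) =
        ennreal t * (indicator \<Gamma> x0 + ?I \<mu>) + ennreal (1 - t) * (indicator \<Gamma> x0 + ?I \<nu>)"
      using \<mu> \<nu> \<Gamma> by (simp add: emeasure_lincomb_measure[OF sets] occ_measures_def)
    also have "\<dots> = (ennreal t + ennreal (1 - t)) * indicator \<Gamma> x0 +
        (ennreal t * ?I \<mu> + ennreal (1 - t) * ?I \<nu>)"
      by (simp only: distrib_left distrib_right ac_simps)
    also have "\<dots> = indicator \<Gamma> x0 + ?I ?\<rho>"
      by (simp add: weights nn_integral_lincomb_measure[OF sets])
    finally show ?thesis .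
  qed
  moreover have "(\<integral>\<^sup>+(x, b). total_cost M x b \<partial>?\<rho>) < \<infinity>"
    using \<mu> \<nu>
    by (simp add: nn_integral_lincomb_measure[OF sets] occ_measures_def ennreal_mult_less_top)
  ultimately show ?thesis
    using s\<mu> by (simp add: occ_measures_def)
qed

lemma int_cost_finite:
  assumes "\<mu> \<in> occ_measures M x0" "j \<le> ncons M"
  shows "int_cost M j \<mu> < \<infinity>"
proof -
  have "cost M j x b \<le> total_cost M x b" for x b
    unfolding total_cost_def using assms(2)
    by (intro member_le_sum) auto
  then have "int_cost M j \<mu> \<le> (\<integral>\<^sup>+(x, b). total_cost M x b \<partial>\<mu>)"
    unfolding int_cost_def by (intro nn_integral_mono) auto
  also have "\<dots> < \<infinity>" using assms(1) by (simp add: occ_measures_def)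
  finally show ?thesis .
qed

lemma enn2real_int_cost_mix:
  assumes \<mu>: "\<mu> \<in> occ_measures M x0" and \<nu>: "\<nu> \<in> occ_measures M x0"
    and t: "0 \<le> t" "t \<le> 1" and j: "j \<le> ncons M"
  shows "enn2real (int_cost M j (lincomb_measure (ennreal t) (ennreal (1 - t)) \<mu> \<nu>)) =
    t * enn2real (int_cost M j \<mu>) + (1 - t) * enn2real (int_cost M j \<nu>)"
proof -
  have sets: "sets \<nu> = sets \<mu>" using \<mu> \<nu> by (simp add: occ_measures_def)
  show ?thesis
    using int_cost_finite[OF \<mu> j] int_cost_finite[OF \<nu> j] t
    by (simp add: int_cost_def nn_integral_lincomb_measure[OF sets] enn2real_plus
        ennreal_mult_less_top enn2real_mult)
qed

section \<open>Existence of Lagrange multipliers\<close>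

text \<open>
  All that the duality argument uses of convexity: the domain carries no linear structure, but
  any weighted average of the values at two points is dominated, in all functions of the family
  at once, by the values at a third point.
\<close>

definition convexlike :: "'m set \<Rightarrow> ('m \<Rightarrow> real) set \<Rightarrow> bool" where
  "convexlike D F \<longleftrightarrow> (\<forall>\<mu>\<in>D. \<forall>\<nu>\<in>D. \<forall>t\<in>{0..1}. \<exists>\<rho>\<in>D. \<forall>f\<in>F. f \<rho> \<le> t * f \<mu> + (1 - t) * f \<nu>)"

lemma convexlikeE:
  assumes "convexlike D F" "\<mu> \<in> D" "\<nu> \<in> D" "0 \<le> t" "t \<le> 1"
  obtains \<rho> where "\<rho> \<in> D" "\<And>f. f \<in> F \<Longrightarrow> f \<rho> \<le> t * f \<mu> + (1 - t) * f \<nu>"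
  using assms unfolding convexlike_def by (metis atLeastAtMost_iff)

text \<open>
  The multiplier is the least slope $g \ge 0$ with $p \le f(\mu) + g\,h(\mu)$ at all points with
  $h(\mu) > 0$. It does not exceed any slope allowed by a point with $h(\nu) < 0$, since the
  chord from $\mu$ to $\nu$ dominates, where its constraint value is $0$, a point with
  $h \le 0$, whose objective value is at least $p$.
\<close>

lemma lagrange_multiplier_single:
  fixes f h :: "'m \<Rightarrow> real"
  assumes conv: "convexlike D {f, h}"
    and lower: "\<And>\<mu>. \<mu> \<in> D \<Longrightarrow> h \<mu> \<le> 0 \<Longrightarrow> p \<le> f \<mu>"
    and slater: "\<exists>\<mu>\<in>D. h \<mu> < 0"
  shows "\<exists>g\<ge>0. \<forall>\<mu>\<in>D. p \<le> f \<mu> + g * h \<mu>"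
proof -
  define P where "P = insert 0 ((\<lambda>\<mu>. (p - f \<mu>) / h \<mu>) ` {\<mu>\<in>D. 0 < h \<mu>})"
  have below: "s \<le> (f \<nu> - p) / (- h \<nu>)" if s: "s \<in> P" and \<nu>: "\<nu> \<in> D" "h \<nu> < 0" for s \<nu>
  proof -
    consider "s = 0" | \<mu> where "\<mu> \<in> D" "0 < h \<mu>" "s = (p - f \<mu>) / h \<mu>"
      using s by (auto simp: P_def)
    then show ?thesis
    proof cases
      case 1
      then show ?thesis using lower[of \<nu>] \<nu> by (simp add: divide_nonneg_neg)
    next
      case 2
      \<comment> \<open>the weight at which the chord has constraint value $0$\<close>
      define t where "t = - h \<nu> / (h \<mu> - h \<nu>)"
      have d: "0 < h \<mu> - h \<nu>" using 2 \<nu> by simp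
      have t: "0 \<le> t" "t \<le> 1" using 2 \<nu> by (auto simp: t_def divide_simps)
      have t': "1 - t = h \<mu> / (h \<mu> - h \<nu>)" using d by (simp add: t_def field_simps)
      obtain \<rho> where \<rho>: "\<rho> \<in> D" "\<And>k. k \<in> {f, h} \<Longrightarrow> k \<rho> \<le> t * k \<mu> + (1 - t) * k \<nu>"
        using convexlikeE[OF conv 2(1) \<nu>(1) t] by metis
      have "t * h \<mu> + (1 - t) * h \<nu> = 0"
        unfolding t' using d by (simp add: t_def field_simps)
      then have "h \<rho> \<le> 0" using \<rho>(2)[of h] by simp
      then have "p \<le> t * f \<mu> + (1 - t) * f \<nu>"
        using lower[OF \<rho>(1)] \<rho>(2)[of f] by simp
      also have "\<dots> = (h \<mu> * f \<nu> - h \<nu> * f \<mu>) / (h \<mu> - h \<nu>)"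
        unfolding t' by (simp add: t_def diff_divide_distrib)
      finally have "p * (h \<mu> - h \<nu>) \<le> h \<mu> * f \<nu> - h \<nu> * f \<mu>"
        using d by (simp add: pos_le_divide_eq)
      then have "(p - f \<mu>) * (- h \<nu>) \<le> (f \<nu> - p) * h \<mu>"
        by (simp add: algebra_simps)
      then have "(p - f \<mu>) / h \<mu> \<le> (f \<nu> - p) / (- h \<nu>)"
        using 2(2) \<nu>(2) by (subst frac_le_eq) (auto intro!: divide_nonpos_neg mult_pos_neg)
      then show ?thesis using 2(3) by simp
    qed
  qed
  have ne: "P \<noteq> {}" by (simp add: P_def)
  have bdd: "bdd_above P" using slater below by (meson bdd_above.I)
  define g where "g = Sup P"
  have upper: "s \<le> g" if "s \<in> P" for s
    unfolding g_def using that bdd by (rule cSup_upper)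
  have "0 \<le> g" by (rule upper) (simp add: P_def)
  moreover have "p \<le> f \<mu> + g * h \<mu>" if \<mu>: "\<mu> \<in> D" for \<mu>
  proof (cases "h \<mu>" "0::real" rule: linorder_cases)
    case less
    have "g \<le> (f \<mu> - p) / (- h \<mu>)"
      unfolding g_def using below \<mu> less by (intro cSup_least[OF ne]) auto
    then have "g * (- h \<mu>) \<le> f \<mu> - p"
      using less by (subst (asm) pos_le_divide_eq) auto
    then show ?thesis by simp
  next
    case equal
    then show ?thesis using lower[OF \<mu>] by simp
  next
    case greater
    have "(p - f \<mu>) / h \<mu> \<le> g"
      using \<mu> greater by (intro upper) (auto simp: P_def)
    then show ?thesis using greater by (simp add: pos_divide_le_eq)
  qed
  ultimately show ?thesis by blast
qed

text \<open>
  The induction changes both the domain and the objective: the new constraint is dualized on the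
  part of the domain where the old ones hold, and the old ones are then dualized on the full domain
  for the objective augmented by the new term. Both problems inherit the Slater point, and the
  single-constraint multiplier says exactly that \<^term>\<open>p\<close> is still a lower bound in the second.
\<close>

lemma lagrange_multipliers:
  fixes f :: "'m \<Rightarrow> real" and h :: "'i \<Rightarrow> 'm \<Rightarrow> real"
  assumes "finite S" and "convexlike D (insert f (h ` S))"
    and "\<And>\<mu>. \<mu> \<in> D \<Longrightarrow> \<forall>j\<in>S. h j \<mu> \<le> 0 \<Longrightarrow> p \<le> f \<mu>"
    and "\<exists>\<mu>\<in>D. \<forall>j\<in>S. h j \<mu> < 0"
  shows "\<exists>g. (\<forall>j\<in>S. 0 \<le> g j) \<and> (\<forall>\<mu>\<in>D. p \<le> f \<mu> + (\<Sum>j\<in>S. g j * h j \<mu>))"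
  using assms
proof (induction S arbitrary: f rule: finite_induct)
  case empty
  then show ?case by simp
next
  case (insert k S)
  note conv = insert.prems(1) and lower = insert.prems(2)
  obtain \<mu>0 where \<mu>0: "\<mu>0 \<in> D" "\<forall>j\<in>insert k S. h j \<mu>0 < 0"
    using insert.prems(3) by blast
  define D' where "D' = {\<mu>\<in>D. \<forall>j\<in>S. h j \<mu> \<le> 0}"
  have conv': "convexlike D' {f, h k}"
    unfolding convexlike_def
  proof (intro ballI)
    fix \<mu> \<nu> t assume *: "\<mu> \<in> D'" "\<nu> \<in> D'" "t \<in> {0..1::real}"
    then obtain \<rho> where \<rho>: "\<rho> \<in> D"
        "\<And>q. q \<in> insert f (h ` insert k S) \<Longrightarrow> q \<rho> \<le> t * q \<mu> + (1 - t) * q \<nu>"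
      using convexlikeE[OF conv, of \<mu> \<nu> t] by (auto simp: D'_def)
    have "h j \<rho> \<le> 0" if j: "j \<in> S" for j
    proof -
      have "h j \<rho> \<le> t * h j \<mu> + (1 - t) * h j \<nu>" using \<rho>(2) j by simp
      also have "\<dots> \<le> 0"
        using * j by (intro add_nonpos_nonpos mult_nonneg_nonpos) (auto simp: D'_def)
      finally show ?thesis .
    qed
    then show "\<exists>\<rho>\<in>D'. \<forall>q\<in>{f, h k}. q \<rho> \<le> t * q \<mu> + (1 - t) * q \<nu>"
      using \<rho> by (auto simp: D'_def)
  qed
  have "\<exists>\<gamma>\<ge>0. \<forall>\<mu>\<in>D'. p \<le> f \<mu> + \<gamma> * h k \<mu>"
    using conv'
  proof (rule lagrange_multiplier_single)
    show "p \<le> f \<mu>" if "\<mu> \<in> D'" "h k \<mu> \<le> 0" for \<mu>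
      using that lower by (auto simp: D'_def)
    show "\<exists>\<mu>\<in>D'. h k \<mu> < 0"
      using \<mu>0 by (auto simp: D'_def less_imp_le)
  qed
  then obtain \<gamma> where \<gamma>: "0 \<le> \<gamma>" "\<And>\<mu>. \<mu> \<in> D' \<Longrightarrow> p \<le> f \<mu> + \<gamma> * h k \<mu>" by blast
  let ?f = "\<lambda>\<mu>. f \<mu> + \<gamma> * h k \<mu>"
  have "\<exists>g. (\<forall>j\<in>S. 0 \<le> g j) \<and> (\<forall>\<mu>\<in>D. p \<le> ?f \<mu> + (\<Sum>j\<in>S. g j * h j \<mu>))"
  proof (rule insert.IH)
    show "convexlike D (insert ?f (h ` S))"
      unfolding convexlike_def
    proof (intro ballI)
      fix \<mu> \<nu> t assume "\<mu> \<in> D" "\<nu> \<in> D" "t \<in> {0..1::real}"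
      then obtain \<rho> where \<rho>: "\<rho> \<in> D"
          "\<And>q. q \<in> insert f (h ` insert k S) \<Longrightarrow> q \<rho> \<le> t * q \<mu> + (1 - t) * q \<nu>"
        using convexlikeE[OF conv, of \<mu> \<nu> t] by auto
      have "f \<rho> \<le> t * f \<mu> + (1 - t) * f \<nu>" using \<rho>(2) by simp
      moreover have "\<gamma> * h k \<rho> \<le> \<gamma> * (t * h k \<mu> + (1 - t) * h k \<nu>)"
        using \<rho>(2) \<gamma>(1) by (intro mult_left_mono) auto
      ultimately have "?f \<rho> \<le> t * ?f \<mu> + (1 - t) * ?f \<nu>"
        by (simp add: algebra_simps)
      then show "\<exists>\<rho>\<in>D. \<forall>q\<in>insert ?f (h ` S). q \<rho> \<le> t * q \<mu> + (1 - t) * q \<nu>"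
        using \<rho> by (intro bexI[of _ \<rho>]) auto
    qed
    show "p \<le> ?f \<mu>" if "\<mu> \<in> D" "\<forall>j\<in>S. h j \<mu> \<le> 0" for \<mu>
      using that \<gamma>(2) by (simp add: D'_def)
    show "\<exists>\<mu>\<in>D. \<forall>j\<in>S. h j \<mu> < 0" using \<mu>0 by blast
  qed
  then obtain g where g: "\<And>j. j \<in> S \<Longrightarrow> 0 \<le> g j"
      "\<And>\<mu>. \<mu> \<in> D \<Longrightarrow> p \<le> ?f \<mu> + (\<Sum>j\<in>S. g j * h j \<mu>)" by blast
  have "(\<Sum>j\<in>S. (g(k := \<gamma>)) j * h j \<mu>) = (\<Sum>j\<in>S. g j * h j \<mu>)" for \<mu>
    using insert.hyps by (intro sum.cong) auto
  then show ?case
    using insert.hyps \<gamma>(1) g by (intro exI[of _ "g(k := \<gamma>)"]) (auto simp: add.assoc)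
qed

section \<open>Strong duality and saddle points\<close>

text \<open>
  Primal and dual values are taken in \<^typ>\<open>ereal\<close>, since the supremum over the multipliers is
  infinite at infeasible points. The lower bound \<^term>\<open>c\<close> keeps the primal value finite from below.
\<close>

locale slater_program =
  fixes D :: "'m set" and S :: "'i set" and f :: "'m \<Rightarrow> real" and h :: "'i \<Rightarrow> 'm \<Rightarrow> real"
    and c :: real
  assumes finite_S: "finite S"
    and conv: "convexlike D (insert f (h ` S))"
    and bounded: "\<And>\<mu>. \<mu> \<in> D \<Longrightarrow> c \<le> f \<mu>"
    and slater: "\<exists>\<mu>\<in>D. \<forall>j\<in>S. h j \<mu> < 0"
begin

definition mult :: "('i \<Rightarrow> real) set" where
  "mult = PiE S (\<lambda>_. {0..})"

definition lag :: "'m \<Rightarrow> ('i \<Rightarrow> real) \<Rightarrow> real" where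
  "lag \<mu> g = f \<mu> + (\<Sum>j\<in>S. g j * h j \<mu>)"

definition primal :: "'m \<Rightarrow> ereal" where
  "primal \<mu> = (SUP g\<in>mult. ereal (lag \<mu> g))"

definition dual :: "('i \<Rightarrow> real) \<Rightarrow> ereal" where
  "dual g = (INF \<mu>\<in>D. ereal (lag \<mu> g))"

definition feasible :: "'m \<Rightarrow> bool" where
  "feasible \<mu> \<longleftrightarrow> (\<forall>j\<in>S. h j \<mu> \<le> 0)"

definition saddle_point :: "'m \<Rightarrow> ('i \<Rightarrow> real) \<Rightarrow> bool" where
  "saddle_point \<mu> g \<longleftrightarrow> (\<forall>\<nu>\<in>D. \<forall>g'\<in>mult. lag \<mu> g' \<le> lag \<mu> g \<and> lag \<mu> g \<le> lag \<nu> g)"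

definition kkt_point :: "'m \<Rightarrow> ('i \<Rightarrow> real) \<Rightarrow> bool" where
  "kkt_point \<mu> g \<longleftrightarrow> feasible \<mu> \<and> ereal (lag \<mu> g) = dual g \<and> (\<Sum>j\<in>S. g j * h j \<mu>) = 0"

definition optimal_pair :: "'m \<Rightarrow> ('i \<Rightarrow> real) \<Rightarrow> bool" where
  "optimal_pair \<mu> g \<longleftrightarrow>
     is_arg_min primal (\<lambda>\<nu>. \<nu> \<in> D) \<mu> \<and> is_arg_max dual (\<lambda>g'. g' \<in> mult) g"

lemma zero_mult: "(\<lambda>j\<in>S. 0) \<in> mult"
  by (auto simp: mult_def)

lemma lag_zero: "lag \<mu> (\<lambda>j\<in>S. 0) = f \<mu>"
  by (simp add: lag_def)

lemma lag_le_primal: "g \<in> mult \<Longrightarrow> ereal (lag \<mu> g) \<le> primal \<mu>"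
  unfolding primal_def by (rule SUP_upper)

lemma dual_le_lag: "\<mu> \<in> D \<Longrightarrow> dual g \<le> ereal (lag \<mu> g)"
  unfolding dual_def by (rule INF_lower)

lemma weak_duality: "\<mu> \<in> D \<Longrightarrow> g \<in> mult \<Longrightarrow> dual g \<le> primal \<mu>"
  using dual_le_lag lag_le_primal by (rule order_trans)

lemma feasible_sum_nonpos:
  assumes "feasible \<mu>" "g \<in> mult"
  shows "(\<Sum>j\<in>S. g j * h j \<mu>) \<le> 0"
  using assms by (intro sum_nonpos mult_nonneg_nonpos) (auto simp: feasible_def mult_def PiE_iff)

lemma primal_feasible:
  assumes "feasible \<mu>"
  shows "primal \<mu> = ereal (f \<mu>)"
proof (rule antisym)
  show "primal \<mu> \<le> ereal (f \<mu>)"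
    unfolding primal_def using feasible_sum_nonpos[OF assms]
    by (intro SUP_least) (simp add: lag_def)
  show "ereal (f \<mu>) \<le> primal \<mu>"
    using lag_le_primal[OF zero_mult] by (simp add: lag_zero)
qed

text \<open>
  The Slater point and the bound \<^term>\<open>c\<close> make the primal value a real number, to which
  \<open>lagrange_multipliers\<close> applies.
\<close>

lemma dual_attains_primal_value: "\<exists>g\<in>mult. dual g = (INF \<mu>\<in>D. primal \<mu>)"
proof -
  let ?p = "INF \<mu>\<in>D. primal \<mu>"
  obtain \<mu>0 where \<mu>0: "\<mu>0 \<in> D" "\<forall>j\<in>S. h j \<mu>0 < 0" using slater by blast
  have "?p \<le> ereal (f \<mu>0)"
    using \<mu>0 primal_feasible[of \<mu>0] by (auto simp: feasible_def less_imp_le intro: INF_lower2)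
  moreover have "ereal c \<le> ?p"
  proof (rule INF_greatest)
    fix \<mu> assume "\<mu> \<in> D"
    then have "ereal c \<le> ereal (lag \<mu> (\<lambda>j\<in>S. 0))" using bounded by (simp add: lag_zero)
    also have "\<dots> \<le> primal \<mu>" by (rule lag_le_primal[OF zero_mult])
    finally show "ereal c \<le> primal \<mu>" .
  qed
  ultimately obtain p where p: "?p = ereal p" by (cases ?p) auto
  have "p \<le> f \<mu>" if "\<mu> \<in> D" "\<forall>j\<in>S. h j \<mu> \<le> 0" for \<mu>
  proof -
    have "?p \<le> primal \<mu>" using that(1) by (rule INF_lower)
    then show ?thesis using that(2) by (simp add: p primal_feasible feasible_def)
  qed
  from lagrange_multipliers[OF finite_S conv this slater]
  obtain g where g: "\<And>j. j \<in> S \<Longrightarrow> 0 \<le> g j"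
      "\<And>\<mu>. \<mu> \<in> D \<Longrightarrow> p \<le> f \<mu> + (\<Sum>j\<in>S. g j * h j \<mu>)" by blast
  have m: "restrict g S \<in> mult" using g(1) by (auto simp: mult_def)
  have "?p \<le> dual (restrict g S)"
    unfolding p dual_def using g(2) by (intro INF_greatest) (simp add: lag_def)
  moreover have "dual (restrict g S) \<le> ?p"
    using m by (intro INF_greatest weak_duality)
  ultimately show ?thesis using m by (intro bexI[of _ "restrict g S"] antisym) auto
qed

lemma strong_duality: "(INF \<mu>\<in>D. primal \<mu>) = (SUP g\<in>mult. dual g)"
proof (rule antisym)
  show "(INF \<mu>\<in>D. primal \<mu>) \<le> (SUP g\<in>mult. dual g)"
    using dual_attains_primal_value by (metis SUP_upper)
  show "(SUP g\<in>mult. dual g) \<le> (INF \<mu>\<in>D. primal \<mu>)"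
    by (intro SUP_least INF_greatest weak_duality)
qed

lemma is_arg_max_dual_iff:
  "is_arg_max dual (\<lambda>g. g \<in> mult) g \<longleftrightarrow> g \<in> mult \<and> dual g = (INF \<mu>\<in>D. primal \<mu>)"
proof -
  have "dual g' \<le> (INF \<mu>\<in>D. primal \<mu>)" if "g' \<in> mult" for g'
    using that by (intro INF_greatest weak_duality)
  then show ?thesis
    using dual_attains_primal_value unfolding is_arg_max_def
    by (metis leD leI order_antisym)
qed

lemma dual_solution_exists: "\<exists>g. is_arg_max dual (\<lambda>g. g \<in> mult) g"
  using dual_attains_primal_value by (auto simp: is_arg_max_dual_iff)

text \<open>The dual functional is an infimum of functions that are affine in the multiplier.\<close>

lemma dual_concave:
  assumes t: "t \<in> {0..1}"
  shows "ereal t * dual g + ereal (1 - t) * dual g'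
    \<le> dual (\<lambda>j\<in>S. t * g j + (1 - t) * g' j)"
  unfolding dual_def[of "\<lambda>j\<in>S. t * g j + (1 - t) * g' j"]
proof (rule INF_greatest)
  fix \<mu> assume \<mu>: "\<mu> \<in> D"
  have "ereal t * dual g + ereal (1 - t) * dual g'
      \<le> ereal t * ereal (lag \<mu> g) + ereal (1 - t) * ereal (lag \<mu> g')"
    using t by (intro add_mono ereal_mult_left_mono dual_le_lag \<mu>) auto
  also have "\<dots> = ereal (lag \<mu> (\<lambda>j\<in>S. t * g j + (1 - t) * g' j))"
    by (simp add: lag_def algebra_simps sum.distrib sum_distrib_left sum_subtractf)
  finally show "ereal t * dual g + ereal (1 - t) * dual g'
      \<le> ereal (lag \<mu> (\<lambda>j\<in>S. t * g j + (1 - t) * g' j))" .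
qed

lemma optimal_imp_saddle:
  assumes "optimal_pair \<mu> g"
  shows "saddle_point \<mu> g"
proof -
  have \<mu>: "\<mu> \<in> D" and g: "g \<in> mult" and d: "dual g = (INF \<nu>\<in>D. primal \<nu>)"
    using assms by (auto simp: optimal_pair_def is_arg_max_dual_iff is_arg_min_def)
  have "primal \<mu> \<le> dual g"
    unfolding d using assms
    by (intro INF_greatest) (auto simp: optimal_pair_def is_arg_min_def not_less)
  then have "ereal (lag \<mu> g') \<le> ereal (lag \<nu> g)" if "g' \<in> mult" "\<nu> \<in> D" for g' \<nu>
    using lag_le_primal[OF that(1), of \<mu>] dual_le_lag[OF that(2), of g] by (meson order_trans)
  then show ?thesis using \<mu> g by (simp add: saddle_point_def)
qed

text \<open>
  Maximality in the multiplier forces feasibility, since raising the multiplier of a violated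
  constraint increases the Lagrangian, and complementary slackness, by comparison with the zero
  multiplier.
\<close>

lemma saddle_imp_kkt:
  assumes \<mu>: "\<mu> \<in> D" and g: "g \<in> mult" and saddle: "saddle_point \<mu> g"
  shows "kkt_point \<mu> g"
proof -
  have max: "lag \<mu> g' \<le> lag \<mu> g" if "g' \<in> mult" for g'
    using saddle \<mu> that by (auto simp: saddle_point_def)
  have feas: "feasible \<mu>"
    unfolding feasible_def
  proof
    fix k assume k: "k \<in> S"
    let ?g = "g(k := g k + 1)"
    have "?g \<in> mult" using g k by (auto simp: mult_def PiE_iff extensional_def)
    moreover have "lag \<mu> ?g = lag \<mu> g + h k \<mu>"
      by (simp add: lag_def sum.remove[OF finite_S k] algebra_simps)
    ultimately show "h k \<mu> \<le> 0" using max[of ?g] by simp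
  qed
  have "f \<mu> \<le> lag \<mu> g" using max[OF zero_mult] by (simp add: lag_zero)
  then have "(\<Sum>j\<in>S. g j * h j \<mu>) = 0"
    using feasible_sum_nonpos[OF feas g] by (simp add: lag_def)
  moreover have "ereal (lag \<mu> g) \<le> dual g"
    unfolding dual_def using saddle g by (intro INF_greatest) (auto simp: saddle_point_def)
  ultimately show ?thesis
    using feas dual_le_lag[OF \<mu>, of g] by (auto simp: kkt_point_def intro: antisym)
qed

lemma kkt_imp_optimal:
  assumes \<mu>: "\<mu> \<in> D" and g: "g \<in> mult" and kkt: "kkt_point \<mu> g"
  shows "optimal_pair \<mu> g"
proof -
  have "primal \<mu> = dual g"
    using kkt by (auto simp: kkt_point_def primal_feasible lag_def)
  then show ?thesis
    using \<mu> g weak_duality[OF _ g] weak_duality[OF \<mu>]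
    by (auto simp: optimal_pair_def is_arg_min_def is_arg_max_def not_less)
qed

lemma optimality_conditions:
  assumes "\<mu> \<in> D" "g \<in> mult"
  shows "optimal_pair \<mu> g \<longleftrightarrow> saddle_point \<mu> g" "optimal_pair \<mu> g \<longleftrightarrow> kkt_point \<mu> g"
  using optimal_imp_saddle saddle_imp_kkt[OF assms] kkt_imp_optimal[OF assms] by blast+

end

section \<open>Duality for the impulse control model\<close>

theorem theorem2:
  fixes M :: "('x::polish_space, 'a::polish_space) impulse_model"
    and x0 :: "'x option"
  assumes model: "valid_model M"
    and x0: "x0 \<in> vset M"
    and semicont: "semicontinuous_mdp M"
    and slater: "\<exists>\<mu>\<in>occ_measures M x0. \<forall>j\<in>{1..ncons M}. int_cost M j \<mu> < ennreal (bound M j)"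
  shows
    "(INF \<mu>\<in>occ_measures M x0. SUP g\<in>multipliers M. ereal (lagrangian M \<mu> g)) =
       (SUP g\<in>multipliers M. INF \<mu>\<in>occ_measures M x0. ereal (lagrangian M \<mu> g))
     \<and> (\<exists>g. is_arg_max (dual_fun M x0) (\<lambda>g. g \<in> multipliers M) g)
     \<and> (\<forall>g\<in>multipliers M. \<forall>g'\<in>multipliers M. \<forall>t\<in>{0..1}.
          ereal t * dual_fun M x0 g + ereal (1 - t) * dual_fun M x0 g'
            \<le> dual_fun M x0 (\<lambda>j\<in>{1..ncons M}. t * g j + (1 - t) * g' j))
     \<and> (\<forall>\<mu>\<in>occ_measures M x0. \<forall>g\<in>multipliers M.
          let optimal = (is_arg_min (primal_fun M) (\<lambda>\<nu>. \<nu> \<in> occ_measures M x0) \<mu> \<and>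
                         is_arg_max (dual_fun M x0) (\<lambda>g'. g' \<in> multipliers M) g);
              saddle = (\<forall>\<nu>\<in>occ_measures M x0. \<forall>g'\<in>multipliers M.
                         lagrangian M \<mu> g' \<le> lagrangian M \<mu> g \<and>
                         lagrangian M \<mu> g \<le> lagrangian M \<nu> g);
              kkt = ((\<forall>j\<in>{1..ncons M}. int_cost M j \<mu> \<le> ennreal (bound M j)) \<and>
                     ereal (lagrangian M \<mu> g) = (INF \<nu>\<in>occ_measures M x0. ereal (lagrangian M \<nu> g)) \<and>
                     (\<Sum>j\<in>{1..ncons M}. g j * (enn2real (int_cost M j \<mu>) - bound M j)) = 0)
          in (optimal \<longleftrightarrow> saddle) \<and> (optimal \<longleftrightarrow> kkt) \<and> (saddle \<longleftrightarrow> kkt))"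
proof -
  let ?D = "occ_measures M x0" and ?S = "{1..ncons M}"
  let ?f = "\<lambda>\<mu>. enn2real (int_cost M 0 \<mu>)"
  let ?h = "\<lambda>j \<mu>. enn2real (int_cost M j \<mu>) - bound M j"
  have constraint: "int_cost M j \<mu> = ennreal (enn2real (int_cost M j \<mu>))"
    if "\<mu> \<in> ?D" "j \<in> ?S" for \<mu> j
    using int_cost_finite[OF that(1), of j] that(2) by simp
  \<comment> \<open>the Slater point makes the bounds positive, so \<^const>\<open>ennreal\<close> does not truncate them\<close>
  have pos: "0 < bound M j" if "j \<in> ?S" for j
    using slater that by (metis ennreal_less_zero_iff gr_zeroI not_less_zero)
  interpret slater_program ?D ?S ?f ?h 0
  proof
    show "convexlike ?D (insert ?f (?h ` ?S))"
      unfolding convexlike_def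
    proof (intro ballI)
      fix \<mu> \<nu> t assume *: "\<mu> \<in> ?D" "\<nu> \<in> ?D" "t \<in> {0..1::real}"
      let ?\<rho> = "lincomb_measure (ennreal t) (ennreal (1 - t)) \<mu> \<nu>"
      have "?\<rho> \<in> ?D" using * by (intro occ_measures_mix) auto
      moreover have "enn2real (int_cost M j ?\<rho>) =
          t * enn2real (int_cost M j \<mu>) + (1 - t) * enn2real (int_cost M j \<nu>)"
        if "j \<le> ncons M" for j
        using * that by (intro enn2real_int_cost_mix) auto
      ultimately show "\<exists>\<rho>\<in>?D. \<forall>q\<in>insert ?f (?h ` ?S). q \<rho> \<le> t * q \<mu> + (1 - t) * q \<nu>"
        by (intro bexI[of _ ?\<rho>]) (auto simp: algebra_simps)
    qed
    show "\<exists>\<mu>\<in>?D. \<forall>j\<in>?S. ?h j \<mu> < 0"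
    proof -
      obtain \<mu> where \<mu>: "\<mu> \<in> ?D" "\<forall>j\<in>?S. int_cost M j \<mu> < ennreal (bound M j)"
        using slater by blast
      have "?h j \<mu> < 0" if "j \<in> ?S" for j
      proof -
        have "ennreal (enn2real (int_cost M j \<mu>)) < ennreal (bound M j)"
          using \<mu>(2) that constraint[OF \<mu>(1) that] by metis
        then show ?thesis using pos[OF that] by (simp add: ennreal_less_iff)
      qed
      then show ?thesis using \<mu>(1) by blast
    qed
  qed simp_all
  have feasible_iff:
    "(\<forall>j\<in>?S. int_cost M j \<mu> \<le> ennreal (bound M j)) \<longleftrightarrow> feasible \<mu>" if "\<mu> \<in> ?D" for \<mu>
  proof -
    have "int_cost M j \<mu> \<le> ennreal (bound M j) \<longleftrightarrow> ?h j \<mu> \<le> 0" if j: "j \<in> ?S" for j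
      using pos[OF j] by (subst constraint[OF \<open>\<mu> \<in> ?D\<close> j]) (simp add: ennreal_le_iff)
    then show ?thesis unfolding feasible_def by (intro ball_cong refl)
  qed
  have mult: "multipliers M = mult"
    unfolding multipliers_def mult_def ..
  have lag: "lagrangian M = lag"
    by (intro ext) (simp only: lagrangian_def lag_def)
  have primal: "primal_fun M = primal"
    by (intro ext) (simp only: primal_fun_def primal_def mult lag)
  have dual: "dual_fun M x0 = dual"
    by (intro ext) (simp only: dual_fun_def dual_def lag)
  have value_eq: "(INF \<mu>\<in>?D. SUP g\<in>mult. ereal (lag \<mu> g)) =
      (SUP g\<in>mult. INF \<mu>\<in>?D. ereal (lag \<mu> g))"
    using strong_duality by (simp only: primal_def dual_def)
  show ?thesis
    unfolding mult lag primal dual Let_def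
  proof (intro conjI ballI value_eq dual_solution_exists dual_concave)
    fix \<mu> g assume "\<mu> \<in> ?D" "g \<in> mult"
    note conds = optimality_conditions[OF this, unfolded optimal_pair_def saddle_point_def
        kkt_point_def dual_def[of g] feasible_iff[OF \<open>\<mu> \<in> ?D\<close>, symmetric]]
    show "(is_arg_min primal (\<lambda>\<nu>. \<nu> \<in> ?D) \<mu> \<and> is_arg_max dual (\<lambda>g'. g' \<in> mult) g) \<longleftrightarrow>
        (\<forall>\<nu>\<in>?D. \<forall>g'\<in>mult. lag \<mu> g' \<le> lag \<mu> g \<and> lag \<mu> g \<le> lag \<nu> g)"
      by (rule conds(1))
    show "(is_arg_min primal (\<lambda>\<nu>. \<nu> \<in> ?D) \<mu> \<and> is_arg_max dual (\<lambda>g'. g' \<in> mult) g) \<longleftrightarrow>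
        ((\<forall>j\<in>?S. int_cost M j \<mu> \<le> ennreal (bound M j)) \<and>
         ereal (lag \<mu> g) = (INF \<nu>\<in>?D. ereal (lag \<nu> g)) \<and>
         (\<Sum>j\<in>?S. g j * ?h j \<mu>) = 0)"
      by (rule conds(2))
    show "(\<forall>\<nu>\<in>?D. \<forall>g'\<in>mult. lag \<mu> g' \<le> lag \<mu> g \<and> lag \<mu> g \<le> lag \<nu> g) \<longleftrightarrow>
        ((\<forall>j\<in>?S. int_cost M j \<mu> \<le> ennreal (bound M j)) \<and>
         ereal (lag \<mu> g) = (INF \<nu>\<in>?D. ereal (lag \<nu> g)) \<and>
         (\<Sum>j\<in>?S. g j * ?h j \<mu>) = 0)"
      unfolding conds(1)[symmetric] by (rule conds(2))
  qed
qed

end
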